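(* Let $\mathcal{M}_1$ and $\mathcal{M}_2$ be any two generalized partition matroids on the same ground set. Then \[ \chi_\ell(\mathcal{M}_1\cap\mathcal{M}_2)=\chi(\mathcal{M}_1\cap\mathcal{M}_2)=\max\big(\chi(\mathcal{M}_1),\chi(\mathcal{M}_2)\big). \]
   Context: A complex $\mathcal{C}$ is a finite set of finite sets closed under taking subsets; its members are called faces, and $V=V(\mathcal{C})=\bigcup\mathcal{C}$ is its ground set. A matroid is a complex $\mathcal{M}$ with $\emptyset\in\mathcal{M}$ such that for any $S,T\in\mathcal{M}$ with $|S|<|T|$ there exists $v\in T\setminus S$ with $S\cup\{v\}\in\mathcal{M}$. Generalized partition matroid: the (finite) ground set is partitioned into sets $P_1,\dots,P_a$ and positive integers $p_1,\dots,p_a$ (the constraints) are given; a subset $I$ of the ground set belongs to $\mathcal{M}$ if and only if $|I\cap P_i|\le p_i$ for each $1\le i\le a$. The two matroids $\mathcal{M}_1,\mathcal{M}_2$ may have different partitions and different constraints. $\mathcal{M}_1\cap\mathcal{M}_2$ is the complex of all sets that belong to both $\mathcal{M}_1$ and $\mathcal{M}_2$. Chromatic number: a $\mathcal{C}$-respecting coloring is a set of faces of $\mathcal{C}$ whose union is $V(\mathcal{C})$; $\chi(\mathcal{C})$ is the minimum number of faces in a $\mathcal{C}$-respecting coloring. List chromatic number: given lists (sets) $(L_v : v\in V)$ of permissible colors, a list coloring is a function $f:V\to\bigcup_{v\in V}L_v$ with $f(v)\in L_v$ for every $v\in V$; it is $\mathcal{C}$-respecting if $f^{-1}(c)\in\mathcal{C}$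 for every color $c\in\bigcup_{v\in V}L_v$. $\chi_\ell(\mathcal{C})$ is the minimal integer $p$ such that any lists $(L_v:v\in V)$ with $|L_v|=p$ for each $v\in V$ admit a $\mathcal{C}$-respecting list coloring. *)

theory Defs
  imports Main "HOL-Library.FuncSet" "HOL-Library.Disjoint_Sets" "HOL-Library.Infinite_Typeclass"
begin

definition is_complex :: "'a set set \<Rightarrow> bool" where
  "is_complex C \<longleftrightarrow> finite C \<and> (\<forall>S\<in>C. finite S) \<and> (\<forall>S\<in>C. \<forall>T. T \<subseteq> S \<longrightarrow> T \<in> C)"

definition ground :: "'a set set \<Rightarrow> 'a set" where
  "ground C = \<Union>C"

definition is_matroid :: "'a set set \<Rightarrow> bool" where
  "is_matroid M \<longleftrightarrow> is_complex M \<and> {} \<in> M \<and>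
     (\<forall>S\<in>M. \<forall>T\<in>M. card S < card T \<longrightarrow> (\<exists>v\<in>T - S. S \<union> {v} \<in> M))"

text \<open>Parts \<open>P i\<close> are allowed to be empty; this does not enlarge the class of matroids.\<close>

definition gen_partition_matroid_on :: "'a set \<Rightarrow> 'a set set \<Rightarrow> bool" where
  "gen_partition_matroid_on V M \<longleftrightarrow> finite V \<and>
     (\<exists>(a::nat) (P :: nat \<Rightarrow> 'a set) (p :: nat \<Rightarrow> nat).
        disjoint_family_on P {1..a} \<and> (\<Union>i\<in>{1..a}. P i) = V \<and> (\<forall>i\<in>{1..a}. 0 < p i) \<and>
        M = {I. I \<subseteq> V \<and> (\<forall>i\<in>{1..a}. card (I \<inter> P i) \<le> p i)})"

definition respecting_coloring :: "'a set set \<Rightarrow> 'a set set \<Rightarrow> bool" where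
  "respecting_coloring C F \<longleftrightarrow> F \<subseteq> C \<and> \<Union>F = ground C"

definition chromatic_number :: "'a set set \<Rightarrow> nat" where
  "chromatic_number C = (LEAST k. \<exists>F. respecting_coloring C F \<and> finite F \<and> card F = k)"

definition list_coloring :: "'a set \<Rightarrow> ('a \<Rightarrow> 'c set) \<Rightarrow> ('a \<Rightarrow> 'c) \<Rightarrow> bool" where
  "list_coloring V L f \<longleftrightarrow> f \<in> Pi V L"

definition respecting_list_coloring :: "'a set set \<Rightarrow> ('a \<Rightarrow> 'c set) \<Rightarrow> ('a \<Rightarrow> 'c) \<Rightarrow> bool" where
  "respecting_list_coloring C L f \<longleftrightarrow> list_coloring (ground C) L f \<and>
     (\<forall>c \<in> (\<Union>v\<in>ground C. L v). f -` {c} \<inter> ground C \<in> C)"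

text \<open>The type argument is the supply of colors. It has to be infinite: over a finite color type
  there are no lists of large size, so the condition below would be vacuous for large \<open>p\<close>.\<close>

definition list_chromatic_number :: "'c::infinite itself \<Rightarrow> 'a set set \<Rightarrow> nat" where
  "list_chromatic_number _ C = (LEAST p. \<forall>L :: 'a \<Rightarrow> 'c set.
     (\<forall>v\<in>ground C. finite (L v) \<and> card (L v) = p) \<longrightarrow> (\<exists>f. respecting_list_coloring C L f))"

lemma ground_gen_partition_matroid:
  assumes "gen_partition_matroid_on V M"
  shows "ground M = V"
proof -
  obtain a :: nat and P p where *: "\<forall>i\<in>{1..a}. 0 < p i"
      "M = {I. I \<subseteq> V \<and> (\<forall>i\<in>{1..a}. card (I \<inter> P i) \<le> p i)}"
    using assms unfolding gen_partition_matroid_on_def by blast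
  have "{v} \<in> M" if "v \<in> V" for v
  proof -
    have "card ({v} \<inter> P i) \<le> p i" if "i \<in> {1..a}" for i
      using *(1) that by (cases "v \<in> P i") (auto simp: Suc_le_eq)
    with that show ?thesis by (auto simp: *(2))
  qed
  then show ?thesis by (auto simp: ground_def *(2))
qed

lemma gen_partition_matroid_is_matroid:
  assumes "gen_partition_matroid_on V M"
  shows "is_matroid M"
proof -
  obtain a :: nat and P p where fin: "finite V" and dis: "disjoint_family_on P {1..a}"
      and un: "(\<Union>i\<in>{1..a}. P i) = V"
      and M: "M = {I. I \<subseteq> V \<and> (\<forall>i\<in>{1..a}. card (I \<inter> P i) \<le> p i)}"
    using assms unfolding gen_partition_matroid_on_def by blast
  have fS: "finite S" if "S \<in> M" for S
    using that fin by (auto simp: M intro: finite_subset)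
  have down: "T \<in> M" if S: "S \<in> M" and "T \<subseteq> S" for S T
  proof -
    have "card (T \<inter> P i) \<le> p i" if i: "i \<in> {1..a}" for i
    proof -
      have "card (T \<inter> P i) \<le> card (S \<inter> P i)"
        using fS[OF S] \<open>T \<subseteq> S\<close> by (intro card_mono) auto
      also have "\<dots> \<le> p i" using S i by (auto simp: M)
      finally show ?thesis .
    qed
    with that show ?thesis by (auto simp: M)
  qed
  have "finite M" by (rule finite_subset[of _ "Pow V"]) (use fin M in auto)
  with fS down have cpl: "is_complex M" unfolding is_complex_def by blast
  have cardsum: "card S = (\<Sum>i\<in>{1..a}. card (S \<inter> P i))" if S: "S \<in> M" for S
  proof -
    have "S = (\<Union>i\<in>{1..a}. S \<inter> P i)" using S un by (auto simp: M)
    also have "card \<dots> = (\<Sum>i\<in>{1..a}. card (S \<inter> P i))"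
      using fS[OF S] dis by (intro card_UN_disjoint) (auto simp: disjoint_family_on_def)
    finally show ?thesis .
  qed
  have exch: "\<exists>v\<in>T - S. S \<union> {v} \<in> M" if S: "S \<in> M" and T: "T \<in> M" and lt: "card S < card T" for S T
  proof -
    have "\<exists>i\<in>{1..a}. card (S \<inter> P i) < card (T \<inter> P i)"
    proof (rule ccontr)
      assume "\<not> ?thesis"
      then have "card T \<le> card S"
        unfolding cardsum[OF S] cardsum[OF T] by (intro sum_mono) (auto simp: not_less)
      with lt show False by simp
    qed
    then obtain i where i: "i \<in> {1..a}" and less: "card (S \<inter> P i) < card (T \<inter> P i)" by blast
    have "\<not> T \<inter> P i \<subseteq> S \<inter> P i"
      using less fS[OF S] by (metis card_mono finite_Int not_less)
    then obtain v where v: "v \<in> T" "v \<in> P i" "v \<notin> S" by blast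
    have "card ((S \<union> {v}) \<inter> P j) \<le> p j" if j: "j \<in> {1..a}" for j
    proof (cases "j = i")
      case True
      have "(S \<union> {v}) \<inter> P i = insert v (S \<inter> P i)" using v by auto
      moreover have "card (T \<inter> P i) \<le> p i" using T i by (auto simp: M)
      ultimately show ?thesis using v less True fS[OF S] by simp
    next
      case False
      then have "v \<notin> P j" using v disjoint_family_onD[OF dis j i] by auto
      then have "(S \<union> {v}) \<inter> P j = S \<inter> P j" by auto
      then show ?thesis using S j by (auto simp: M)
    qed
    moreover have "S \<union> {v} \<subseteq> V" using S T v by (auto simp: M)
    ultimately show ?thesis using v by (auto simp: M)
  qed
  have "{} \<in> M" by (auto simp: M)
  with cpl exch show ?thesis unfolding is_matroid_def by blast
qed

end

theory Submission
  imports Defs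
begin

text \<open>If \<open>k\<close> faces cover the ground set, then \<open>|P i| \<le> k * p i\<close> for every part. Conversely, under these
  inequalities each part \<open>P i\<close> splits into \<open>p i\<close> blocks of size at most \<open>k\<close>, and every set that meets
  each block at most once is a face. Reading ground set elements as edges joining their block
  for \<open>M1\<close> to their block for \<open>M2\<close> gives a bipartite multigraph of maximum degree at most \<open>k\<close>, and the
  claim becomes Galvin's theorem: by Koenig this multigraph has a proper edge coloring with \<open>k\<close> colors;
  that coloring orients the line graph so that every outdegree is less than \<open>k\<close> and every
  induced subgraph has a kernel (a stable matching), so colors can be removed one at a time.\<close>

section \<open>Edge colorings of bipartite multigraphs\<close>

text \<open>The elements of \<open>S\<close> are the edges of a bipartite multigraph; the edge \<open>e\<close> joins \<open>g e\<close> to \<open>h e\<close>.\<close>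

definition proper_edge_coloring :: "('a \<Rightarrow> 'b) \<Rightarrow> ('a \<Rightarrow> 'd) \<Rightarrow> 'a set \<Rightarrow> ('a \<Rightarrow> 'c) \<Rightarrow> bool" where
  "proper_edge_coloring g h S c \<longleftrightarrow>
     (\<forall>u\<in>S. \<forall>v\<in>S. u \<noteq> v \<longrightarrow> c u = c v \<longrightarrow> g u \<noteq> g v \<and> h u \<noteq> h v)"

lemma proper_edge_coloringD:
  assumes "proper_edge_coloring g h S c" "u \<in> S" "v \<in> S" "c u = c v"
  shows "g u = g v \<Longrightarrow> u = v" and "h u = h v \<Longrightarrow> u = v"
  using assms unfolding proper_edge_coloring_def by blast+

lemma proper_edge_coloring_subset:
  "proper_edge_coloring g h S c \<Longrightarrow> T \<subseteq> S \<Longrightarrow> proper_edge_coloring g h T c"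
  unfolding proper_edge_coloring_def by blast

text \<open>The chain is a set of edges, not a path. Bipartiteness fixes the direction of travel:
  left vertices are crossed from \<open>a\<close> to \<open>b\<close>, right vertices from
  \<open>b\<close> to \<open>a\<close>.\<close>

inductive_set kempe_chain :: "('a \<Rightarrow> 'b) \<Rightarrow> ('a \<Rightarrow> 'd) \<Rightarrow> 'a set \<Rightarrow> ('a \<Rightarrow> 'c) \<Rightarrow> 'c \<Rightarrow> 'c \<Rightarrow> 'd \<Rightarrow> 'a set"
  for g h S c a b y where
  start: "e \<in> S \<Longrightarrow> c e = a \<Longrightarrow> h e = y \<Longrightarrow> e \<in> kempe_chain g h S c a b y"
| via_left: "e \<in> kempe_chain g h S c a b y \<Longrightarrow> c e = a \<Longrightarrow> e' \<in> S \<Longrightarrow> c e' = b \<Longrightarrow> g e' = g e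
    \<Longrightarrow> e' \<in> kempe_chain g h S c a b y"
| via_right: "e \<in> kempe_chain g h S c a b y \<Longrightarrow> c e = b \<Longrightarrow> e' \<in> S \<Longrightarrow> c e' = a \<Longrightarrow> h e' = h e
    \<Longrightarrow> e' \<in> kempe_chain g h S c a b y"

text \<open>The chain leaves \<open>y\<close> through an \<open>a\<close>-edge, so it reaches left vertices only through \<open>a\<close>-edges and
  never visits a left vertex \<open>x\<close> at which \<open>a\<close> is missing. Swapping \<open>a\<close> and \<open>b\<close> along it
  makes \<open>a\<close> missing at both \<open>x\<close> and \<open>y\<close>.\<close>

lemma kempe_swap:
  assumes proper: "proper_edge_coloring g h S c" and range: "c \<in> S \<rightarrow> C" and "a \<in> C" "b \<in> C"
    and a: "\<And>e. e \<in> S \<Longrightarrow> g e = x \<Longrightarrow> c e \<noteq> a"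
    and b: "\<And>e. e \<in> S \<Longrightarrow> h e = y \<Longrightarrow> c e \<noteq> b"
  obtains c' where "proper_edge_coloring g h S c'" "c' \<in> S \<rightarrow> C"
    "\<And>e. e \<in> S \<Longrightarrow> g e = x \<or> h e = y \<Longrightarrow> c' e \<noteq> a"
proof (cases "a = b")
  case True
  with assms that[of c] show ?thesis by blast
next
  case False
  define R where "R = kempe_chain g h S c a b y"
  define c' where "c' e = (if e \<in> R then (if c e = a then b else a) else c e)" for e
  have color: "c e = a \<or> c e = b" if "e \<in> R" for e
    using that unfolding R_def by cases auto
  \<comment> \<open>The rule that put \<open>e\<close> into the chain supplies a predecessor: a
    \<open>b\<close>-edge enters through its left end, an \<open>a\<close>-edge through its right
    end or as a start at \<open>y\<close>.\<close>
  have from_left: "\<exists>e'\<in>R. c e' = a \<and> g e' = g e \<and> e' \<in> S" if "e \<in> R" "c e = b" for e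
    using that(1)[unfolded R_def]
  proof cases
    case (via_left e')
    moreover have "e' \<in> S" using via_left(1) by cases auto
    ultimately show ?thesis unfolding R_def by metis
  qed (use that(2) False in auto)
  have from_right: "h e = y \<or> (\<exists>e'\<in>R. c e' = b \<and> h e' = h e \<and> e' \<in> S)" if "e \<in> R" "c e = a" for e
    using that(1)[unfolded R_def]
  proof cases
    case (via_right e')
    moreover have "e' \<in> S" using via_right(1) by cases auto
    ultimately show ?thesis unfolding R_def by metis
  qed (use that(2) False in auto)
  \<comment> \<open>The old colors of \<open>u\<close> and \<open>v\<close> are \<open>a\<close> and
    \<open>b\<close> in some order. At one end of \<open>u\<close> the chain would absorb an
    adjacent \<open>v\<close>; at the other, properness would make \<open>v\<close> the predecessor
    of \<open>u\<close>, unless that end is \<open>y\<close>, where \<open>b\<close> is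
    missing.\<close>
  have mixed: "g u \<noteq> g v \<and> h u \<noteq> h v"
    if uv: "u \<in> S" "v \<in> S" "u \<in> R" "v \<notin> R" "c' u = c' v" for u v
  proof (cases "c u = a")
    case True
    then have v: "c v = b" using uv by (simp add: c'_def)
    have "g u \<noteq> g v"
      using uv True v kempe_chain.via_left[of u g h S c a b y v] unfolding R_def by auto
    moreover have "h u \<noteq> h v"
      using from_right[OF uv(3) True] b[of v] v uv proper_edge_coloringD(2)[OF proper] by metis
    ultimately show ?thesis ..
  next
    case u: False
    then have u: "c u = b" using color uv by blast
    have v: "c v = a" using uv u False by (simp add: c'_def)
    have "h u \<noteq> h v"
      using uv u v kempe_chain.via_right[of u g h S c a b y v] unfolding R_def by auto
    moreover have "g u \<noteq> g v"
      using from_left[OF uv(3) u] v uv proper_edge_coloringD(1)[OF proper] by metis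
    ultimately show ?thesis by blast
  qed
  have "proper_edge_coloring g h S c'"
    unfolding proper_edge_coloring_def
  proof (intro ballI impI)
    fix u v assume uv: "u \<in> S" "v \<in> S" "u \<noteq> v" "c' u = c' v"
    show "g u \<noteq> g v \<and> h u \<noteq> h v"
    proof (cases "u \<in> R \<longleftrightarrow> v \<in> R")
      case True
      then have "c u = c v"
        using uv color[of u] color[of v] False by (auto simp: c'_def split: if_splits)
      with uv proper_edge_coloringD[OF proper uv(1,2)] show ?thesis by blast
    next
      case False
      with mixed[of u v] mixed[of v u] uv show ?thesis by metis
    qed
  qed
  moreover have "c' \<in> S \<rightarrow> C"
    using range \<open>a \<in> C\<close> \<open>b \<in> C\<close> by (auto simp: c'_def)
  \<comment> \<open>A \<open>b\<close>-edge of the chain shares its left end with an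
    \<open>a\<close>-edge, so that end is not \<open>x\<close>; an \<open>a\<close>-edge at
    \<open>y\<close> starts the chain and is recolored.\<close>
  moreover have "c' e \<noteq> a" if e: "e \<in> S" "g e = x \<or> h e = y" for e
  proof
    assume ca: "c' e = a"
    show False
    proof (cases "e \<in> R")
      case True
      then have "c e = b" using ca color[OF True] False by (auto simp: c'_def)
      with from_left[OF True this] a b e show False by metis
    next
      case nR: False
      then have "c e = a" using ca by (simp add: c'_def)
      with nR a e kempe_chain.start[of e S c a h y g b] show False unfolding R_def by auto
    qed
  qed
  ultimately show ?thesis using that by blast
qed

text \<open>\<open>q\<close> stands for either end map. The degree bound also counts the uncolored
  \<open>e\<close>, so fewer than \<open>k\<close> colors are in use at that end.\<close>

lemma missing_color:
  fixes S :: "'a set" and c :: "'a \<Rightarrow> nat"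
  assumes "finite S" "e \<notin> S" "card {u \<in> insert e S. q u = q e} \<le> k"
  obtains a where "a < k" "\<And>u. u \<in> S \<Longrightarrow> q u = q e \<Longrightarrow> c u \<noteq> a"
proof -
  let ?U = "{u \<in> S. q u = q e}"
  have "{u \<in> insert e S. q u = q e} = insert e ?U" by auto
  then have "card ?U < k" using assms by simp
  moreover have "card (c ` ?U) \<le> card ?U" using assms(1) by (intro card_image_le) auto
  ultimately have "\<not> {..<k} \<subseteq> c ` ?U"
    using assms(1) card_mono[of "c ` ?U" "{..<k}"] by auto
  then show ?thesis using that by blast
qed

text \<open>Edges are inserted one at a time. Each end of the new edge misses a color; a Kempe swap
  makes the color missing on the left missing on the right too.\<close>

theorem koenig_edge_coloring:
  assumes "finite S"
    and "\<And>e. e \<in> S \<Longrightarrow> card {u \<in> S. g u = g e} \<le> k"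
    and "\<And>e. e \<in> S \<Longrightarrow> card {u \<in> S. h u = h e} \<le> k"
  shows "\<exists>c \<in> S \<rightarrow> {..<k}. proper_edge_coloring g h S c"
  using assms
proof (induction S)
  case empty
  then show ?case by (auto simp: proper_edge_coloring_def)
next
  case (insert e S)
  have "card {u \<in> S. g u = g v} \<le> k" "card {u \<in> S. h u = h v} \<le> k" if "v \<in> S" for v
    by (rule order_trans[OF card_mono insert.prems(1)[of v]]; use that insert.hyps(1) in auto)
      (rule order_trans[OF card_mono insert.prems(2)[of v]]; use that insert.hyps(1) in auto)
  then obtain c where c: "c \<in> S \<rightarrow> {..<k}" "proper_edge_coloring g h S c"
    using insert.IH by blast
  obtain a where a: "a < k" "\<And>u. u \<in> S \<Longrightarrow> g u = g e \<Longrightarrow> c u \<noteq> a"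
    using missing_color[OF insert.hyps insert.prems(1)[OF insertI1]] by blast
  obtain b where b: "b < k" "\<And>u. u \<in> S \<Longrightarrow> h u = h e \<Longrightarrow> c u \<noteq> b"
    using missing_color[OF insert.hyps insert.prems(2)[OF insertI1]] by blast
  have "a \<in> {..<k}" "b \<in> {..<k}" using a(1) b(1) by simp_all
  from kempe_swap[OF c(2,1) this a(2) b(2)]
  obtain c' where c': "proper_edge_coloring g h S c'" "c' \<in> S \<rightarrow> {..<k}"
      "\<And>u. u \<in> S \<Longrightarrow> g u = g e \<or> h u = h e \<Longrightarrow> c' u \<noteq> a"
    by blast
  have "c'(e := a) \<in> insert e S \<rightarrow> {..<k}" using c'(2) a(1) by auto
  moreover have "proper_edge_coloring g h (insert e S) (c'(e := a))"
    unfolding proper_edge_coloring_def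
  proof (intro ballI impI)
    fix u v
    assume uv: "u \<in> insert e S" "v \<in> insert e S" "u \<noteq> v" "(c'(e := a)) u = (c'(e := a)) v"
    then consider "u = e" "v \<in> S" "c' v = a" | "v = e" "u \<in> S" "c' u = a"
      | "u \<in> S" "v \<in> S" "c' u = c' v"
      by (auto split: if_splits)
    then show "g u \<noteq> g v \<and> h u \<noteq> h v"
    proof cases
      case 1
      then show ?thesis using c'(3)[of v] by metis
    next
      case 2
      then show ?thesis using c'(3)[of u] by metis
    next
      case 3
      then show ?thesis using proper_edge_coloringD[OF c'(1), of u v] uv(3) by blast
    qed
  qed
  ultimately show ?case by blast
qed

section \<open>Galvin's theorem\<close>

text \<open>Left vertices prefer edges of large color, right vertices edges of small color.\<close>

definition dominates :: "('a \<Rightarrow> 'b) \<Rightarrow> ('a \<Rightarrow> 'd) \<Rightarrow> ('a \<Rightarrow> nat) \<Rightarrow> 'a \<Rightarrow> 'a \<Rightarrow> bool" where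
  "dominates g h c f e \<longleftrightarrow> g f = g e \<and> c e < c f \<or> h f = h e \<and> c f < c e"

text \<open>Deferred acceptance as in Gale and Shapley: left vertices propose their favorite edges,
  and a right vertex rejects the worse of two proposals.\<close>

lemma stable_matching:
  assumes "finite T" "proper_edge_coloring g h T c"
  shows "\<exists>K\<subseteq>T. inj_on g K \<and> inj_on h K \<and> (\<forall>e\<in>T - K. \<exists>f\<in>K. dominates g h c f e)"
  using assms
proof (induction "card T" arbitrary: T rule: less_induct)
  case less
  define M where "M = {e \<in> T. \<forall>f\<in>T. g f = g e \<longrightarrow> c f \<le> c e}"
  have "inj_on g M"
  proof (rule inj_onI)
    fix u v assume "u \<in> M" "v \<in> M" "g u = g v"
    moreover from this have "c u = c v" by (auto simp: M_def intro!: antisym)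
    ultimately show "u = v"
      using proper_edge_coloringD(1)[OF less.prems(2), of u v] by (auto simp: M_def)
  qed
  show ?case
  proof (cases "inj_on h M")
    case True
    have "\<exists>f\<in>M. dominates g h c f e" if e: "e \<in> T - M" for e
    proof -
      let ?A = "{f \<in> T. g f = g e}"
      have A: "finite ?A" "?A \<noteq> {}" using less.prems(1) e by auto
      then have "Max (c ` ?A) \<in> c ` ?A" by (intro Max_in) auto
      then obtain f where f: "f \<in> ?A" "c f = Max (c ` ?A)" by auto
      have max: "c u \<le> c f" if "u \<in> ?A" for u using that A f(2) by auto
      have "f \<in> M" using f(1) max by (auto simp: M_def)
      moreover have "c e \<noteq> c f"
        using proper_edge_coloringD(1)[OF less.prems(2), of e f] e f(1) \<open>f \<in> M\<close> by auto
      ultimately show ?thesis using f(1) max[of e] e by (auto simp: dominates_def)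
    qed
    with True \<open>inj_on g M\<close> show ?thesis by (intro exI[of _ M]) (auto simp: M_def)
  next
    case False
    then obtain u v where "u \<in> M" "v \<in> M" "h u = h v" "u \<noteq> v" unfolding inj_on_def by blast
    moreover from this have "c u \<noteq> c v"
      using proper_edge_coloringD(2)[OF less.prems(2), of u v] by (auto simp: M_def)
    \<comment> \<open>Two favorites collide at a right vertex, which prefers the smaller color;
      \<open>e'\<close> is rejected and the induction hypothesis is applied to the rest.\<close>
    ultimately obtain e e' where e: "e \<in> M" "e' \<in> M" "h e = h e'" "c e < c e'"
      by (metis nat_neq_iff)
    then have "e \<in> T" "e' \<in> T" by (auto simp: M_def)
    have "card (T - {e'}) < card T" by (rule card_Diff1_less[OF less.prems(1) \<open>e' \<in> T\<close>])
    then obtain K where K: "K \<subseteq> T - {e'}" "inj_on g K" "inj_on h K"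
        "\<forall>f\<in>T - {e'} - K. \<exists>f'\<in>K. dominates g h c f' f"
      using less.hyps[of "T - {e'}"] less.prems proper_edge_coloring_subset[OF less.prems(2), of "T - {e'}"]
      by auto
    \<comment> \<open>Since \<open>e\<close> is the best edge at its left vertex, whatever dominates it does so at \<open>h e\<close>.\<close>
    have "\<exists>f\<in>K. dominates g h c f e'"
    proof (cases "e \<in> K")
      case True
      then show ?thesis using e by (auto simp: dominates_def)
    next
      case False
      then obtain f where f: "f \<in> K" "dominates g h c f e" using K(4) \<open>e \<in> T\<close> e(4) by auto
      have "g f = g e \<longrightarrow> c f \<le> c e" using e(1) f(1) K(1) by (auto simp: M_def)
      then show ?thesis using f e by (auto simp: dominates_def intro!: bexI[of _ f])
    qed
    with K show ?thesis by (intro exI[of _ K]) auto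
  qed
qed

text \<open>The kernel method of Bondy, Boppana and Siegel: a color goes to a kernel of the edges
  whose lists contain it and is struck from all other lists. The strict inequality survives each
  round.\<close>

lemma list_edge_coloring_if_dominators_less:
  assumes "finite S" "proper_edge_coloring g h S c"
    and "\<And>e. e \<in> S \<Longrightarrow> finite (L e) \<and> card {f \<in> S. dominates g h c f e} < card (L e)"
  shows "\<exists>l \<in> Pi S L. proper_edge_coloring g h S l"
  using assms
proof (induction "card S" arbitrary: S L rule: less_induct)
  case less
  show ?case
  proof (cases "S = {}")
    case True
    then show ?thesis by (auto simp: proper_edge_coloring_def)
  next
    case False
    then obtain e0 where e0: "e0 \<in> S" by blast
    then have "L e0 \<noteq> {}" using less.prems(3)[OF e0] by auto
    then obtain \<alpha> where \<alpha>: "\<alpha> \<in> L e0" by blast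
    define T where "T = {e \<in> S. \<alpha> \<in> L e}"
    have T: "T \<subseteq> S" "finite T" "e0 \<in> T" using less.prems(1) e0 \<alpha> by (auto simp: T_def)
    obtain K where K: "K \<subseteq> T" "inj_on g K" "inj_on h K"
        "\<forall>e\<in>T - K. \<exists>f\<in>K. dominates g h c f e"
      using stable_matching[OF T(2) proper_edge_coloring_subset[OF less.prems(2) T(1)]] by blast
    have "K \<noteq> {}" using K T(3) by auto
    have smaller: "card (S - K) < card S"
      using K(1) T(1) \<open>K \<noteq> {}\<close> by (intro psubset_card_mono[OF less.prems(1)]) auto
    \<comment> \<open>Outside \<open>T\<close> no color is lost. Inside \<open>T\<close>, the loss
      of \<open>\<alpha>\<close> is offset by the loss of a dominator lying in
      \<open>K\<close>.\<close>
    have lists: "finite (L e - {\<alpha>}) \<and> card {f \<in> S - K. dominates g h c f e} < card (L e - {\<alpha>})"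
      if e: "e \<in> S - K" for e
    proof (cases "e \<in> T")
      case True
      then obtain f where f: "f \<in> K" "dominates g h c f e" using K(4) e by blast
      then have "{f \<in> S - K. dominates g h c f e} \<subset> {f \<in> S. dominates g h c f e}"
        using K(1) T(1) by blast
      then have "card {f \<in> S - K. dominates g h c f e} < card {f \<in> S. dominates g h c f e}"
        using less.prems(1) by (intro psubset_card_mono) auto
      moreover have "card (L e - {\<alpha>}) = card (L e) - 1"
        using True less.prems(3)[of e] e by (auto simp: T_def)
      ultimately show ?thesis using less.prems(3)[of e] e by auto
    next
      case False
      then have "L e - {\<alpha>} = L e" using e by (auto simp: T_def)
      moreover have "card {f \<in> S - K. dominates g h c f e} \<le> card {f \<in> S. dominates g h c f e}"
        using less.prems(1) by (intro card_mono) auto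
      ultimately show ?thesis using less.prems(3)[of e] e by auto
    qed
    have "\<exists>l \<in> Pi (S - K) (\<lambda>e. L e - {\<alpha>}). proper_edge_coloring g h (S - K) l"
      using less.hyps[OF smaller _ _ lists] less.prems(1)
        proper_edge_coloring_subset[OF less.prems(2), of "S - K"] by auto
    then obtain l where l: "l \<in> Pi (S - K) (\<lambda>e. L e - {\<alpha>})" "proper_edge_coloring g h (S - K) l"
      by blast
    let ?l = "\<lambda>e. if e \<in> K then \<alpha> else l e"
    have "?l \<in> Pi S L" using l(1) K(1) by (auto simp: T_def)
    moreover have "proper_edge_coloring g h S ?l"
      unfolding proper_edge_coloring_def
    proof (intro ballI impI)
      fix u v assume uv: "u \<in> S" "v \<in> S" "u \<noteq> v" "?l u = ?l v"
      have "l w \<noteq> \<alpha>" if "w \<in> S - K" for w using l(1) that by blast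
      with uv have "u \<in> K \<and> v \<in> K \<or> u \<in> S - K \<and> v \<in> S - K \<and> l u = l v"
        by (metis DiffI)
      then show "g u \<noteq> g v \<and> h u \<noteq> h v"
        using K(2,3) l(2) uv(3) unfolding inj_on_def proper_edge_coloring_def by blast
    qed
    ultimately show ?thesis by blast
  qed
qed

theorem galvin:
  assumes "finite S"
    and "\<And>e. e \<in> S \<Longrightarrow> card {u \<in> S. g u = g e} \<le> k"
    and "\<And>e. e \<in> S \<Longrightarrow> card {u \<in> S. h u = h e} \<le> k"
    and L: "\<And>e. e \<in> S \<Longrightarrow> finite (L e) \<and> card (L e) = k"
  shows "\<exists>l \<in> Pi S L. proper_edge_coloring g h S l"
proof -
  obtain c where c: "c \<in> S \<rightarrow> {..<k}" "proper_edge_coloring g h S c"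
    using koenig_edge_coloring[OF assms(1-3)] by blast
  \<comment> \<open>Dominators at the left end have colors above \<open>c e\<close>, those at the
    right end below. Two of equal color thus share an end and coincide; since \<open>c e\<close>
    itself is avoided, at most \<open>k - 1\<close> remain.\<close>
  have "card {f \<in> S. dominates g h c f e} < k" if e: "e \<in> S" for e
  proof -
    have "inj_on c {f \<in> S. dominates g h c f e}"
    proof (rule inj_onI)
      fix u v
      assume uv: "u \<in> {f \<in> S. dominates g h c f e}" "v \<in> {f \<in> S. dominates g h c f e}" "c u = c v"
      then have "g u = g v \<or> h u = h v" by (auto simp: dominates_def)
      with uv proper_edge_coloringD[OF c(2), of u v] show "u = v" by blast
    qed
    moreover have "c ` {f \<in> S. dominates g h c f e} \<subseteq> {..<k} - {c e}"
      using c(1) by (auto simp: dominates_def)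
    ultimately have "card {f \<in> S. dominates g h c f e} \<le> card ({..<k} - {c e})"
      by (intro card_inj_on_le) auto
    also have "\<dots> < k" using funcset_mem[OF c(1) e] by simp
    finally show ?thesis .
  qed
  with L show ?thesis
    by (intro list_edge_coloring_if_dominators_less[OF assms(1) c(2)]) auto
qed

section \<open>Chromatic numbers of complexes and partition matroids\<close>

lemma chromatic_number_le_card:
  "respecting_coloring C F \<Longrightarrow> finite F \<Longrightarrow> chromatic_number C \<le> card F"
  unfolding chromatic_number_def by (rule Least_le) blast

lemma chromatic_number_attained:
  assumes "finite C"
  obtains F where "respecting_coloring C F" "finite F" "card F = chromatic_number C"
proof -
  have "\<exists>k F. respecting_coloring C F \<and> finite F \<and> card F = k"
    using assms by (intro exI[of _ "card C"] exI[of _ C]) (auto simp: respecting_coloring_def ground_def)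
  from LeastI_ex[OF this] show ?thesis using that unfolding chromatic_number_def by blast
qed

lemma chromatic_number_le_of_function:
  assumes "f \<in> ground C \<rightarrow> A" "finite A" "\<And>c. c \<in> A \<Longrightarrow> f -` {c} \<inter> ground C \<in> C"
  shows "chromatic_number C \<le> card A"
proof -
  let ?F = "(\<lambda>c. f -` {c} \<inter> ground C) ` A"
  have "respecting_coloring C ?F"
    using assms(1,3) by (auto simp: respecting_coloring_def)
  then have "chromatic_number C \<le> card ?F" using assms(2) by (intro chromatic_number_le_card) auto
  also have "\<dots> \<le> card A" using assms(2) by (rule card_image_le)
  finally show ?thesis .
qed

lemma chromatic_number_antimono:
  assumes "finite C" "C \<subseteq> D" "ground C = ground D"
  shows "chromatic_number D \<le> chromatic_number C"
proof -
  obtain F where "respecting_coloring C F" "finite F" "card F = chromatic_number C"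
    using chromatic_number_attained[OF assms(1)] .
  with assms chromatic_number_le_card[of D F] show ?thesis
    by (auto simp: respecting_coloring_def)
qed

lemma ground_Int_gen_partition_matroid:
  assumes "gen_partition_matroid_on V M1" "gen_partition_matroid_on V M2"
  shows "ground (M1 \<inter> M2) = V"
proof -
  have singleton: "{v} \<in> M" if M: "gen_partition_matroid_on V M" and v: "v \<in> V" for M v
  proof -
    have "is_complex M"
      using gen_partition_matroid_is_matroid[OF M] by (simp add: is_matroid_def)
    moreover obtain S where "S \<in> M" "v \<in> S"
      using ground_gen_partition_matroid[OF M] v by (auto simp: ground_def)
    ultimately show ?thesis by (auto simp: is_complex_def)
  qed
  have "M1 \<inter> M2 \<subseteq> Pow V"
    using ground_gen_partition_matroid[OF assms(1)] by (auto simp: ground_def)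
  moreover have "{v} \<in> M1 \<inter> M2" if "v \<in> V" for v
    using singleton[OF assms(1) that] singleton[OF assms(2) that] by simp
  ultimately show ?thesis by (force simp: ground_def)
qed

text \<open>The constraints are traded for blocks of capacity 1 and size at most \<open>k\<close>.
  Only one inclusion is asserted: partial transversals of the blocks are faces.\<close>

lemma gen_partition_matroid_blocks:
  assumes M: "gen_partition_matroid_on V M" and k: "chromatic_number M \<le> k"
  obtains g :: "'a \<Rightarrow> nat \<times> nat" where "\<And>v. card {u \<in> V. g u = g v} \<le> k"
    "\<And>S. S \<subseteq> V \<Longrightarrow> inj_on g S \<Longrightarrow> S \<in> M"
proof -
  obtain a :: nat and P p where fin: "finite V" and dis: "disjoint_family_on P {1..a}"
      and un: "(\<Union>i\<in>{1..a}. P i) = V"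
      and Meq: "M = {I. I \<subseteq> V \<and> (\<forall>i\<in>{1..a}. card (I \<inter> P i) \<le> p i)}"
    using M unfolding gen_partition_matroid_on_def by blast
  have "finite M"
    using gen_partition_matroid_is_matroid[OF M] by (simp add: is_matroid_def is_complex_def)
  then obtain F where F: "respecting_coloring M F" "finite F" "card F = chromatic_number M"
    using chromatic_number_attained by blast
  have finP: "finite (P i)" if "i \<in> {1..a}" for i
    using that un fin by (auto intro: finite_subset)
  have bound: "card (P i) \<le> k * p i" if i: "i \<in> {1..a}" for i
  proof -
    have "P i = (\<Union>S\<in>F. S \<inter> P i)"
      using F(1) ground_gen_partition_matroid[OF M] un i by (auto simp: respecting_coloring_def)
    then have "card (P i) \<le> (\<Sum>S\<in>F. card (S \<inter> P i))"
      using card_UN_le[OF F(2), of "\<lambda>S. S \<inter> P i"] by simp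
    also have "\<dots> \<le> (\<Sum>S\<in>F. p i)"
      using F(1) i by (intro sum_mono) (auto simp: respecting_coloring_def Meq)
    also have "\<dots> \<le> k * p i" using F(3) k by simp
    finally show ?thesis .
  qed
  \<comment> \<open>Numbering each part below \<open>k * p i\<close> lets division by
    \<open>k\<close> cut it into at most \<open>p i\<close> blocks.\<close>
  have "\<exists>r. inj_on r (P i) \<and> r ` P i \<subseteq> {..<k * p i}" if i: "i \<in> {1..a}" for i
    using finP[OF i] bound[OF i] by (intro inj_on_iff_card_le[THEN iffD2]) auto
  then obtain r :: "nat \<Rightarrow> 'a \<Rightarrow> nat"
    where r: "\<And>i. i \<in> {1..a} \<Longrightarrow> inj_on (r i) (P i) \<and> r i ` P i \<subseteq> {..<k * p i}" by metis
  have "\<exists>i\<in>{1..a}. v \<in> P i" if "v \<in> V" for v using that un by blast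
  then obtain part where part: "\<And>v. v \<in> V \<Longrightarrow> part v \<in> {1..a} \<and> v \<in> P (part v)" by metis
  have part_eq: "part v = i" if "i \<in> {1..a}" "v \<in> P i" for v i
  proof -
    have "v \<in> V" using that un by blast
    with part[of v] that disjoint_family_onD[OF dis, of "part v" i] show ?thesis by blast
  qed
  define g where "g v = (part v, r (part v) v div k)" for v
  have "card {u \<in> V. g u = g v} \<le> k" for v
  proof (cases "\<exists>w\<in>V. g w = g v")
    case True
    \<comment> \<open>Outside \<open>V\<close> the value \<open>part v\<close> is arbitrary, so the
      class is described through a member \<open>w\<close> of \<open>V\<close>.\<close>
    then obtain w where w: "w \<in> V" "g w = g v" by blast
    define i t where "i = part w" and "t = r i w div k"
    have i: "i \<in> {1..a}" using part w by (auto simp: i_def)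
    have sub: "u \<in> P i \<and> r i u div k = t" if "u \<in> V" "g u = g v" for u
      using that part[of u] w by (auto simp: g_def i_def t_def)
    have "r i w < k * p i" using r[OF i] part[OF w(1)] by (auto simp: i_def)
    then have "0 < k" by (cases k) auto
    have "card {u \<in> V. g u = g v} \<le> card {t * k..<t * k + k}"
    proof (rule card_inj_on_le)
      show "inj_on (r i) {u \<in> V. g u = g v}"
        using r[OF i] sub by (auto intro: inj_on_subset)
      show "r i ` {u \<in> V. g u = g v} \<subseteq> {t * k..<t * k + k}"
      proof (intro image_subsetI)
        fix u assume "u \<in> {u \<in> V. g u = g v}"
        then have "t = r i u div k" using sub by simp
        then show "r i u \<in> {t * k..<t * k + k}"
          using \<open>0 < k\<close> div_times_less_eq_dividend[of "r i u" k] dividend_less_div_times[of k "r i u"]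
          by simp
      qed
    qed simp
    then show ?thesis by simp
  next
    case False
    then have "{u \<in> V. g u = g v} = {}" by blast
    then show ?thesis by (metis card.empty le0)
  qed
  moreover have "S \<in> M" if S: "S \<subseteq> V" "inj_on g S" for S
  proof -
    have "card (S \<inter> P i) \<le> p i" if i: "i \<in> {1..a}" for i
    proof -
      have "card (S \<inter> P i) \<le> card {..<p i}"
      proof (rule card_inj_on_le)
        show "inj_on (\<lambda>v. r i v div k) (S \<inter> P i)"
          using S(2) part_eq[OF i] by (auto simp: inj_on_def g_def)
        show "(\<lambda>v. r i v div k) ` (S \<inter> P i) \<subseteq> {..<p i}"
          using r[OF i] by (auto simp: less_mult_imp_div_less mult.commute[of k])
      qed simp
      then show ?thesis by simp
    qed
    with S(1) show ?thesis by (auto simp: Meq)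
  qed
  ultimately show ?thesis using that by blast
qed

lemma Int_gen_partition_matroids_list_coloring:
  assumes M: "gen_partition_matroid_on V M1" "gen_partition_matroid_on V M2"
    and k: "chromatic_number M1 \<le> k" "chromatic_number M2 \<le> k"
    and L: "\<forall>v\<in>V. finite (L v) \<and> card (L v) = k"
  shows "\<exists>f\<in>Pi V L. \<forall>c. f -` {c} \<inter> V \<in> M1 \<inter> M2"
proof -
  obtain g :: "'a \<Rightarrow> nat \<times> nat" where g: "\<And>v. card {u \<in> V. g u = g v} \<le> k"
      "\<And>S. S \<subseteq> V \<Longrightarrow> inj_on g S \<Longrightarrow> S \<in> M1"
    using gen_partition_matroid_blocks[OF M(1) k(1)] by blast
  obtain h :: "'a \<Rightarrow> nat \<times> nat" where h: "\<And>v. card {u \<in> V. h u = h v} \<le> k"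
      "\<And>S. S \<subseteq> V \<Longrightarrow> inj_on h S \<Longrightarrow> S \<in> M2"
    using gen_partition_matroid_blocks[OF M(2) k(2)] by blast
  have "finite V" using M(1) by (auto simp: gen_partition_matroid_on_def)
  then obtain f where f: "f \<in> Pi V L" "proper_edge_coloring g h V f"
    using galvin[of V g k h L] g(1) h(1) L by blast
  \<comment> \<open>A color class is a matching, so \<open>g\<close> and \<open>h\<close> are
    injective on it.\<close>
  have "f -` {c} \<inter> V \<in> M1 \<inter> M2" for c
    using proper_edge_coloringD[OF f(2)] by (intro IntI g(2) h(2) inj_onI) auto
  with f(1) show ?thesis by blast
qed

theorem theorem1p5:
  fixes V :: "'a set" and M1 M2 :: "'a set set"
  assumes "gen_partition_matroid_on V M1"
    and "gen_partition_matroid_on V M2"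
  shows "list_chromatic_number TYPE('c::infinite) (M1 \<inter> M2) = chromatic_number (M1 \<inter> M2)
    \<and> chromatic_number (M1 \<inter> M2) = max (chromatic_number M1) (chromatic_number M2)"
proof -
  define k where "k = max (chromatic_number M1) (chromatic_number M2)"
  define listable where "listable p \<longleftrightarrow> (\<forall>L :: 'a \<Rightarrow> 'c set.
     (\<forall>v\<in>V. finite (L v) \<and> card (L v) = p) \<longrightarrow> (\<exists>f. respecting_list_coloring (M1 \<inter> M2) L f))" for p
  have V: "ground (M1 \<inter> M2) = V" "ground M1 = V" "ground M2 = V"
    using ground_Int_gen_partition_matroid[OF assms] ground_gen_partition_matroid assms by blast+
  have fin: "finite (M1 \<inter> M2)"
    using gen_partition_matroid_is_matroid[OF assms(1)] by (simp add: is_matroid_def is_complex_def)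
  have list_eq: "list_chromatic_number TYPE('c) (M1 \<inter> M2) = (LEAST p. listable p)"
    unfolding list_chromatic_number_def listable_def V ..
  have "k \<le> chromatic_number (M1 \<inter> M2)"
    unfolding k_def using chromatic_number_antimono[OF fin] V by simp
  \<comment> \<open>Constant lists turn list colorings into ordinary colorings; the infinite color
    type provides a list of size \<open>p\<close>.\<close>
  moreover have "chromatic_number (M1 \<inter> M2) \<le> p" if p: "listable p" for p
  proof -
    obtain A :: "'c set" where A: "finite A" "card A = p"
      using infinite_arbitrarily_large[OF infinite_UNIV] by blast
    then obtain f where "respecting_list_coloring (M1 \<inter> M2) (\<lambda>_. A) f"
      using p[unfolded listable_def, rule_format, of "\<lambda>_. A"] by auto
    then have f: "f \<in> V \<rightarrow> A" "\<forall>c\<in>(\<Union>v\<in>V. A). f -` {c} \<inter> V \<in> M1 \<inter> M2"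
      by (simp_all add: respecting_list_coloring_def list_coloring_def V)
    \<comment> \<open>For empty \<open>V\<close> the union of the lists is empty and the respecting
      condition says nothing; every class is then the empty face.\<close>
    have "{} \<in> M1 \<inter> M2"
      using assms[THEN gen_partition_matroid_is_matroid] by (simp add: is_matroid_def)
    with f have "f -` {c} \<inter> V \<in> M1 \<inter> M2" if "c \<in> A" for c
      using that by (cases "V = {}") auto
    with f(1) A show ?thesis
      using chromatic_number_le_of_function[of f "M1 \<inter> M2" A] V(1) by blast
  qed
  moreover have "listable k"
    unfolding listable_def respecting_list_coloring_def list_coloring_def V
    using Int_gen_partition_matroids_list_coloring[OF assms, of k] by (fastforce simp: k_def)
  moreover from this have "listable (LEAST p. listable p)" "(LEAST p. listable p) \<le> k"
    by (auto intro: LeastI Least_le)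
  \<comment> \<open>The cycle closes: \<open>k\<close> is at most the chromatic number, which is at
    most the least listable \<open>p\<close>, which is at most \<open>k\<close>.\<close>
  ultimately show ?thesis
    unfolding list_eq k_def[symmetric] by (meson antisym order_trans)
qed

end
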